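(* Consider a set of concurrent workers allotted to an operator, where the output unit produced from the input with serial number $t\in\{1,2,3,\dots\}$ is denoted $o_t$. Suppose that all these workers send outputs to the downstream operator by invoking the procedure send of the non-blocking reordering scheme given in the context. Then in every concurrent execution, for every $t\ge 1$, the output $o_t$ is sent downstream (by an invocation of send_downstream$(o_t)$) only after all the outputs $o_1,o_2,\dots,o_{t-1}$ have been sent downstream.
   Context: Model. Finitely many workers (threads) run concurrently on shared memory. Operations on the shared atomic variables (load, set, fetch_add, test_and_set, clear) are atomic and sequentially consistent, so an execution is an interleaving of the workers' steps. $x$.fetch_add(1) atomically increments $x$ and returns the old value; flag.test_and_set() atomically sets the flag and returns its previous value (true iff it was already set); flag.clear() resets it to false. Serial numbers. Each input of the operator carries a unique serial number from $1,2,3,\dots$ (its arrival order). All outputs produced from the input with serial number $t$ are treated as a single unit $o_t$ (even if there are zero or several of them), which is a value different from the special value EMPTY. Outputs may be produced by the workers in any order. For each $t$, the unit $o_t$ is produced once, by one worker. That worker invokes send($o_t$); if the call returns false it invokes send($o_t$) again, repeatedly, and once a call returns true it never invokes send($o_t$) again. Shared data, for a fixed buffer size $s\ge 1$: an atomic integer next, initially 1; an array buffer$[0..s-1]$ of atomic cells, all initially EMPTY; an atomic flag, initially clear. The data is accessed only through the procedures below, and send_downstream is called only from within them. send($o_t$): 1. success := try_add($o_t$) 2. send_pending_outputs() 3. return success try_add($o_t$): 1. $n$ := next.load() 2. if $t\ge n$ and $t<n+s$: let $i := t \bmod s$; buffer$[i]$.set($o_t$); return true 3. otherwise return false send_pending_outputs():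 1. if flag.test_and_set() returns true (flag was already set), return; otherwise continue 2. loop forever: (a) $n$ := next.load(); $i := n \bmod s$; $o$ := buffer$[i]$.load() (b) if $o\ne$ EMPTY: send_downstream($o$); then buffer$[i]$.set(EMPTY); then next.fetch_add(1) (c) otherwise ($o=$ EMPTY): flag.clear() and exit the loop 3. $o$ := buffer$[i]$.load() (with $i$ the last value computed in the loop); if $o\ne$ EMPTY, call send_pending_outputs() The variables $n$, $i$, $o$ and success are local to each invocation. *)

theory Defs
  imports Main "HOL-Library.Extended_Nat"
begin

text \<open>
  The unit \<open>o\<^sub>t\<close> is represented by its serial number: a buffer cell holds \<open>EMPTY\<close> or \<open>Out t\<close>.
\<close>

datatype cell = EMPTY | Out nat

text \<open>
  Program points of a worker. Except for \<open>Idle\<close>, the worker is inside an invocation of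
  send(\<open>o\<^sub>t\<close>), where \<open>t\<close> is the first argument; the boolean is the variable success of send.
  The other arguments are the live local variables of try\_add and send\_pending\_outputs.
  A program point names the operation that the worker executes next. The recursive call in
  send\_pending\_outputs is a tail call after which the caller does nothing but return, so it is
  a jump to \<open>TestAndSet\<close>, and no call stack is needed.
\<close>

datatype control =
    Idle
  | TryAddLoad nat
  | TryAddSet nat
  | TestAndSet nat bool
  | LoadNext nat bool
  | LoadCell nat bool (index: nat)
  | Downstream nat bool (index: nat) (unit: nat)
  | SetEmpty nat bool (index: nat)
  | FetchAdd nat bool (index: nat)
  | Clear nat bool (index: nat)
  | Recheck nat bool (index: nat)
  | Return nat bool

text \<open>
  \<open>produced\<close> contains the serial numbers of all units produced so far. \<open>unsent w\<close> contains those
  produced by worker \<open>w\<close> for which no invocation of send has returned true yet. Of the function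
  \<open>buffer\<close> only the cells \<open>0..s-1\<close> are ever accessed.
\<close>

record 'w state =
  next_var :: nat
  buffer :: "nat \<Rightarrow> cell"
  flag :: bool
  produced :: "nat set"
  unsent :: "'w \<Rightarrow> nat set"
  control :: "'w \<Rightarrow> control"

definition initial :: "'w state" where
  "initial = \<lparr> next_var = 1, buffer = (\<lambda>_. EMPTY), flag = False, produced = {},
     unsent = (\<lambda>_. {}), control = (\<lambda>_. Idle) \<rparr>"

abbreviation goto :: "'w \<Rightarrow> control \<Rightarrow> 'w state \<Rightarrow> 'w state" where
  "goto w c \<sigma> \<equiv> \<sigma>\<lparr> control := (control \<sigma>)(w := c) \<rparr>"

datatype event = Internal | SendDownstream nat

text \<open>
  \<open>step s w e \<sigma> \<sigma>'\<close>: one step of worker \<open>w\<close>, for buffer size \<open>s\<close>. Each step performs at most one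
  operation on the shared data; local computations are part of the preceding load. An idle worker
  may produce a new unit or invoke send for any of its units that are still unsent. In particular,
  after a failed invocation it may repeat that invocation at once, or do something else first.
\<close>

inductive step :: "nat \<Rightarrow> 'w \<Rightarrow> event \<Rightarrow> 'w state \<Rightarrow> 'w state \<Rightarrow> bool" for s :: nat and w :: 'w where
  produce:
    "\<lbrakk> control \<sigma> w = Idle; t \<ge> 1; t \<notin> produced \<sigma> \<rbrakk> \<Longrightarrow>
     step s w Internal \<sigma>
       (\<sigma>\<lparr> produced := insert t (produced \<sigma>),
           unsent := (unsent \<sigma>)(w := insert t (unsent \<sigma> w)) \<rparr>)"
| invoke_send:
    "\<lbrakk> control \<sigma> w = Idle; t \<in> unsent \<sigma> w \<rbrakk> \<Longrightarrow>
     step s w Internal \<sigma> (goto w (TryAddLoad t) \<sigma>)"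
| try_add_load:
    "\<lbrakk> control \<sigma> w = TryAddLoad t; n = next_var \<sigma> \<rbrakk> \<Longrightarrow>
     step s w Internal \<sigma>
       (goto w (if t \<ge> n \<and> t < n + s then TryAddSet t else TestAndSet t False) \<sigma>)"
| try_add_set:
    "\<lbrakk> control \<sigma> w = TryAddSet t; i = t mod s \<rbrakk> \<Longrightarrow>
     step s w Internal \<sigma>
       (goto w (TestAndSet t True) (\<sigma>\<lparr> buffer := (buffer \<sigma>)(i := Out t) \<rparr>))"
| test_and_set:
    "control \<sigma> w = TestAndSet t success \<Longrightarrow>
     step s w Internal \<sigma>
       (goto w (if flag \<sigma> then Return t success else LoadNext t success) (\<sigma>\<lparr> flag := True \<rparr>))"
| load_next:
    "\<lbrakk> control \<sigma> w = LoadNext t success; n = next_var \<sigma>; i = n mod s \<rbrakk> \<Longrightarrow>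
     step s w Internal \<sigma> (goto w (LoadCell t success i) \<sigma>)"
| load_cell:
    "control \<sigma> w = LoadCell t success i \<Longrightarrow>
     step s w Internal \<sigma>
       (goto w (case buffer \<sigma> i of EMPTY \<Rightarrow> Clear t success i
                                 | Out u \<Rightarrow> Downstream t success i u) \<sigma>)"
| send_downstream:
    "control \<sigma> w = Downstream t success i u \<Longrightarrow>
     step s w (SendDownstream u) \<sigma> (goto w (SetEmpty t success i) \<sigma>)"
| set_empty:
    "control \<sigma> w = SetEmpty t success i \<Longrightarrow>
     step s w Internal \<sigma>
       (goto w (FetchAdd t success i) (\<sigma>\<lparr> buffer := (buffer \<sigma>)(i := EMPTY) \<rparr>))"
| fetch_add:
    "control \<sigma> w = FetchAdd t success i \<Longrightarrow>
     step s w Internal \<sigma>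
       (goto w (LoadNext t success) (\<sigma>\<lparr> next_var := next_var \<sigma> + 1 \<rparr>))"
| clear:
    "control \<sigma> w = Clear t success i \<Longrightarrow>
     step s w Internal \<sigma> (goto w (Recheck t success i) (\<sigma>\<lparr> flag := False \<rparr>))"
| recheck:
    "control \<sigma> w = Recheck t success i \<Longrightarrow>
     step s w Internal \<sigma>
       (goto w (if buffer \<sigma> i \<noteq> EMPTY then TestAndSet t success else Return t success) \<sigma>)"
| return_send:
    "control \<sigma> w = Return t success \<Longrightarrow>
     step s w Internal \<sigma>
       (goto w Idle
         (if success then \<sigma>\<lparr> unsent := (unsent \<sigma>)(w := unsent \<sigma> w - {t}) \<rparr> else \<sigma>))"

text \<open>
  A finite or infinite execution with \<open>N\<close> steps: step number \<open>k\<close> leads from \<open>\<sigma> k\<close> to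
  \<open>\<sigma> (Suc k)\<close> and is taken by worker \<open>w k\<close>. No fairness or maximality is required.
\<close>

definition execution ::
  "'w set \<Rightarrow> nat \<Rightarrow> enat \<Rightarrow> (nat \<Rightarrow> 'w state) \<Rightarrow> (nat \<Rightarrow> 'w) \<Rightarrow> (nat \<Rightarrow> event) \<Rightarrow> bool" where
  "execution W s N \<sigma> w e \<longleftrightarrow>
     \<sigma> 0 = initial \<and>
     (\<forall>k. enat k < N \<longrightarrow> w k \<in> W \<and> step s (w k) (e k) (\<sigma> k) (\<sigma> (Suc k)))"

end

theory Submission
  imports Defs
begin

text \<open>
  The flag is a lock on the loop of send\_pending\_outputs, so a single worker sends and advances
  next. Until \<open>o\<^sub>t\<close> is stored, next cannot pass \<open>t\<close>; hence a worker that has tested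
  \<open>t \<in> {next..<next + s}\<close> still satisfies this when it stores \<open>o\<^sub>t\<close>, however late that happens.
  So every stored serial number lies in the current window, where it is determined by its residue
  modulo \<open>s\<close>. The cell that the lock holder reads can therefore only contain the unit number
  next, and the units below next have all been sent.
\<close>

text \<open>A unit stays in \<open>unsent\<close> until \<open>send\<close> returns true, although
  it is stored earlier. This set marks it during the interval in between.\<close>

fun added :: "control \<Rightarrow> nat set" where
  "added (TestAndSet t b) = (if b then {t} else {})"
| "added (LoadNext t b) = (if b then {t} else {})"
| "added (LoadCell t b i) = (if b then {t} else {})"
| "added (Downstream t b i u) = (if b then {t} else {})"
| "added (SetEmpty t b i) = (if b then {t} else {})"
| "added (FetchAdd t b i) = (if b then {t} else {})"
| "added (Clear t b i) = (if b then {t} else {})"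
| "added (Recheck t b i) = (if b then {t} else {})"
| "added (Return t b) = (if b then {t} else {})"
| "added _ = {}"

text \<open>Units that may still be stored in the buffer at some later time.\<close>

definition storable :: "'w state \<Rightarrow> nat set" where
  "storable \<sigma> = {t. t \<ge> 1 \<and>
     (t \<in> produced \<sigma> \<longrightarrow> (\<exists>w. t \<in> unsent \<sigma> w \<and> t \<notin> added (control \<sigma> w)))}"

fun critical :: "control \<Rightarrow> bool" where
  "critical (LoadNext t b) = True"
| "critical (LoadCell t b i) = True"
| "critical (Downstream t b i u) = True"
| "critical (SetEmpty t b i) = True"
| "critical (FetchAdd t b i) = True"
| "critical (Clear t b i) = True"
| "critical _ = False"

text \<open>Below, \<open>S\<close> is the set of units that have already been sent downstream.\<close>

definition local_inv :: "nat \<Rightarrow> nat set \<Rightarrow> 'w state \<Rightarrow> nat set \<Rightarrow> control \<Rightarrow> bool" where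
  "local_inv s S \<sigma> U c = (case c of
       TryAddLoad t \<Rightarrow> t \<in> U
     | TryAddSet t \<Rightarrow> t \<in> U \<and> t < next_var \<sigma> + s
     | LoadCell t b i \<Rightarrow> i = next_var \<sigma> mod s
     | Downstream t b i u \<Rightarrow>
         i = next_var \<sigma> mod s \<and> buffer \<sigma> i = Out (next_var \<sigma>) \<and> u = next_var \<sigma>
     | SetEmpty t b i \<Rightarrow>
         i = next_var \<sigma> mod s \<and> buffer \<sigma> i = Out (next_var \<sigma>) \<and> next_var \<sigma> \<in> S
     | FetchAdd t b i \<Rightarrow>
         i = next_var \<sigma> mod s \<and> buffer \<sigma> i = EMPTY \<and> next_var \<sigma> \<in> S \<and>
         next_var \<sigma> \<notin> storable \<sigma>
     | _ \<Rightarrow> True)"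

definition ownership :: "'w state \<Rightarrow> bool" where
  "ownership \<sigma> \<longleftrightarrow> (\<forall>w. unsent \<sigma> w \<subseteq> produced \<sigma>) \<and>
     (\<forall>w w' t. t \<in> unsent \<sigma> w \<longrightarrow> t \<in> unsent \<sigma> w' \<longrightarrow> w = w') \<and> 0 \<notin> produced \<sigma>"

definition mutex :: "'w state \<Rightarrow> bool" where
  "mutex \<sigma> \<longleftrightarrow> (\<forall>w. critical (control \<sigma> w) \<longrightarrow>
     flag \<sigma> \<and> (\<forall>w'. critical (control \<sigma> w') \<longrightarrow> w' = w))"

text \<open>Excluding buffered units from \<open>storable\<close> expresses that none of them will
  be stored a second time, so no late store can bring a unit back after \<open>next_var\<close> has
  passed it.\<close>

definition in_window :: "nat \<Rightarrow> 'w state \<Rightarrow> bool" where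
  "in_window s \<sigma> \<longleftrightarrow> (\<forall>i u. buffer \<sigma> i = Out u \<longrightarrow>
     i = u mod s \<and> u \<notin> storable \<sigma> \<and> next_var \<sigma> \<le> u \<and> u < next_var \<sigma> + s)"

definition inv :: "nat \<Rightarrow> nat set \<Rightarrow> 'w state \<Rightarrow> bool" where
  "inv s S \<sigma> \<longleftrightarrow> ownership \<sigma> \<and> mutex \<sigma> \<and> in_window s \<sigma> \<and>
     storable \<sigma> \<subseteq> {next_var \<sigma>..} \<and> {1..<next_var \<sigma>} \<subseteq> S \<and>
     (\<forall>w. local_inv s S \<sigma> (unsent \<sigma> w) (control \<sigma> w))"

lemma mod_window_eq:
  fixes u n s :: nat
  assumes "u mod s = n mod s" "n \<le> u" "u < n + s"
  shows "u = n"
proof -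
  have "s dvd u - n" using assms(1,2) by (metis mod_eq_dvd_iff_nat)
  moreover have "u - n < s" using assms by linarith
  ultimately show ?thesis using assms(2) by (auto dest: dvd_imp_le)
qed

lemma inv_initial: "inv s {} initial"
  by (auto simp: inv_def initial_def ownership_def mutex_def in_window_def storable_def
      local_inv_def)

lemma ownership_step:
  assumes "step s w e \<sigma> \<sigma>'" "ownership \<sigma>"
  shows "ownership \<sigma>'"
  using assms by cases (auto simp: ownership_def split: if_splits)

text \<open>A worker enters the critical points only on finding the flag clear, when nobody is
  inside. Only the unique critical worker can clear the flag, and that same step takes it
  outside.\<close>

lemma mutex_step:
  assumes "step s w e \<sigma> \<sigma>'" "mutex \<sigma>"
  shows "mutex \<sigma>'"
proof -
  have "critical (control \<sigma> w) \<Longrightarrow> flag \<sigma> \<and> (\<forall>v. critical (control \<sigma> v) \<longrightarrow> v = w)"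
    using assms(2) by (simp add: mutex_def)
  with assms show ?thesis
    by cases (auto simp: mutex_def split: if_splits cell.splits)
qed

lemma storable_mono:
  assumes "produced \<sigma>' = produced \<sigma>"
    "\<And>v. unsent \<sigma>' v - added (control \<sigma>' v) \<subseteq> unsent \<sigma> v - added (control \<sigma> v)"
  shows "storable \<sigma>' \<subseteq> storable \<sigma>"
  using assms unfolding storable_def by blast

text \<open>A unit counts as storable already before it is produced, so producing it adds nothing.
  On a successful return, \<open>t\<close> leaves \<open>added\<close> and \<open>unsent\<close>
  together.\<close>

lemma storable_step:
  assumes "step s w e \<sigma> \<sigma>'"
  shows "storable \<sigma>' \<subseteq> storable \<sigma>"
  using assms
proof cases
  case (produce t)
  then show ?thesis by (auto simp: storable_def split: if_splits)
qed (rule storable_mono; auto split: if_splits cell.splits)+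

text \<open>By ownership no other worker has \<open>t\<close> among its unsent units, and for
  \<open>w\<close> itself \<open>t\<close> is now in \<open>added\<close>.\<close>

lemma not_storable_try_add_set:
  assumes "control \<sigma> w = TryAddSet t" "t \<in> unsent \<sigma> w" "ownership \<sigma>"
  shows "t \<notin> storable (goto w (TestAndSet t True) (\<sigma>\<lparr> buffer := B \<rparr>))"
  using assms by (auto simp: storable_def ownership_def)

lemma storable_if_try_add_set:
  assumes "control \<sigma> w = TryAddSet t" "t \<in> unsent \<sigma> w" "ownership \<sigma>"
  shows "t \<in> storable \<sigma>"
  using assms by (fastforce simp: storable_def ownership_def Suc_le_eq intro!: gr0I)

text \<open>This serves the workers that do not move while \<open>next_var\<close> is unchanged. The
  only cell that their local conditions mention is the one at
  \<open>next_var \<sigma> mod s\<close>.\<close>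

lemma local_inv_mono:
  assumes "local_inv s S \<sigma> U c" "S \<subseteq> S'" "U \<subseteq> U'" "storable \<sigma>' \<subseteq> storable \<sigma>"
    "next_var \<sigma>' = next_var \<sigma>"
    "critical c \<Longrightarrow> buffer \<sigma>' (next_var \<sigma> mod s) = buffer \<sigma> (next_var \<sigma> mod s)"
  shows "local_inv s S' \<sigma>' U' c"
  using assms by (auto simp: local_inv_def split: control.splits)

text \<open>Outside the critical points only membership in \<open>U\<close> and the upper window
  bound matter, and both survive a growing \<open>next_var\<close>.\<close>

lemma local_inv_not_critical:
  assumes "local_inv s S \<sigma> U c" "\<not> critical c" "U \<subseteq> U'" "next_var \<sigma> \<le> next_var \<sigma>'"
  shows "local_inv s S' \<sigma>' U' c"
  using assms by (auto simp: local_inv_def split: control.splits)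

lemma sent_unit_eq_next:
  assumes "inv s S \<sigma>" "step s w (SendDownstream u) \<sigma> \<sigma>'"
  shows "u = next_var \<sigma>"
  using assms(2)
proof cases
  case (send_downstream t b i)
  then show ?thesis using assms(1) by (force simp: inv_def local_inv_def dest: spec[of _ w])
qed

lemma inv_step:
  assumes I: "inv s S \<sigma>" and st: "step s w e \<sigma> \<sigma>'"
  shows "inv s (S \<union> {u. e = SendDownstream u}) \<sigma>'"
proof -
  let ?S = "S \<union> {u. e = SendDownstream u}"
  have own: "ownership \<sigma>" and mut: "mutex \<sigma>" and win: "in_window s \<sigma>"
    and above: "storable \<sigma> \<subseteq> {next_var \<sigma>..}" and sent: "{1..<next_var \<sigma>} \<subseteq> S"
    and loc: "\<And>v. local_inv s S \<sigma> (unsent \<sigma> v) (control \<sigma> v)"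
    using I by (auto simp: inv_def)
  note own' = ownership_step[OF st own] and mut' = mutex_step[OF st mut]
    and sub = storable_step[OF st]
  have locw: "local_inv s S \<sigma> (unsent \<sigma> w) (control \<sigma> w)" by (rule loc)
  have crit: "\<not> critical (control \<sigma> v)" if "v \<noteq> w" "critical (control \<sigma> w)" for v
    using mut that by (auto simp: mutex_def)
  have "in_window s \<sigma>' \<and> storable \<sigma>' \<subseteq> {next_var \<sigma>'..} \<and> {1..<next_var \<sigma>'} \<subseteq> ?S \<and>
     (\<forall>v. local_inv s ?S \<sigma>' (unsent \<sigma>' v) (control \<sigma>' v))"
  \<comment> \<open>Only \<open>try_add_set\<close>, \<open>set_empty\<close> and
    \<open>fetch_add\<close> can change these two components, so the second case is left with three
    rules.\<close>
  proof (cases "next_var \<sigma>' = next_var \<sigma> \<and> buffer \<sigma>' = buffer \<sigma>")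
    case True
    have win': "in_window s \<sigma>'" using win sub True by (auto simp: in_window_def)
    have others: "local_inv s ?S \<sigma>' (unsent \<sigma>' v) (control \<sigma>' v)" if "v \<noteq> w" for v
    proof -
      have "control \<sigma>' v = control \<sigma> v" "unsent \<sigma>' v = unsent \<sigma> v"
        using st that by (cases; auto)+
      then show ?thesis using local_inv_mono[OF loc[of v] _ _ sub] True by auto
    qed
    have "local_inv s ?S \<sigma>' (unsent \<sigma>' w) (control \<sigma>' w)"
      using st
    proof cases
      case (load_cell t b i)
      then have i: "i = next_var \<sigma> mod s" using locw by (simp add: local_inv_def)
      show ?thesis
      proof (cases "buffer \<sigma> i")
        case (Out u)
        then have "u = next_var \<sigma>" using win i unfolding in_window_def by (metis mod_window_eq)
        then show ?thesis using load_cell i Out by (simp add: local_inv_def)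
      qed (use load_cell in \<open>simp add: local_inv_def\<close>)
    \<comment> \<open>The rule \<open>set_empty\<close> is contradictory here: its cell holds an
      \<open>Out\<close> value, so emptying it would change the buffer.\<close>
    qed (use locw True in \<open>auto simp: local_inv_def fun_upd_idem_iff\<close>)
    then have "\<forall>v. local_inv s ?S \<sigma>' (unsent \<sigma>' v) (control \<sigma>' v)"
      using others by metis
    then show ?thesis using win' above sub sent True by auto
  next
    case False
    from st show ?thesis
    proof cases
      case (try_add_set t i)
      have t: "t \<in> unsent \<sigma> w" "t < next_var \<sigma> + s"
        using locw try_add_set by (auto simp: local_inv_def)
      have st_t: "t \<in> storable \<sigma>" using storable_if_try_add_set try_add_set t own by metis
      have nst: "t \<notin> storable \<sigma>'"
        using not_storable_try_add_set[OF try_add_set(3) t(1) own] try_add_set(2) by simp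
      \<comment> \<open>The test made in \<open>try_add\<close> may be outdated by now; the lower
        bound comes from \<open>t\<close> still being storable.\<close>
      have le: "next_var \<sigma> \<le> t" using above st_t by auto
      have win': "in_window s \<sigma>'"
        using win sub try_add_set(2,4) t le nst unfolding in_window_def by auto
      have "local_inv s ?S \<sigma>' (unsent \<sigma>' v) (control \<sigma>' v)" for v
      proof (cases "v = w")
        case True
        then show ?thesis using try_add_set by (simp add: local_inv_def)
      next
        case False
        have eq: "control \<sigma>' v = control \<sigma> v" "unsent \<sigma>' v = unsent \<sigma> v"
          "next_var \<sigma>' = next_var \<sigma>" using False try_add_set by auto
        show ?thesis
        proof (cases "t mod s = next_var \<sigma> mod s")
          case True
          then have "t = next_var \<sigma>" using mod_window_eq le t(2) by blast
          \<comment> \<open>Since unit \<open>next_var \<sigma>\<close> is only now being stored, no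
            other worker can be at \<open>Downstream\<close>, \<open>SetEmpty\<close> or
            \<open>FetchAdd\<close>. The remaining local conditions do not mention the
            buffer.\<close>
          then have n: "next_var \<sigma> \<in> storable \<sigma>" "buffer \<sigma> (next_var \<sigma> mod s) \<noteq> Out (next_var \<sigma>)"
            using st_t win by (auto simp: in_window_def)
          show ?thesis using loc[of v] n eq by (auto simp: local_inv_def split: control.splits)
        next
          case False
          then show ?thesis using local_inv_mono[OF loc[of v] _ _ sub] eq try_add_set by auto
        qed
      qed
      then show ?thesis using win' above sub sent try_add_set by auto
    next
      case (set_empty t b i)
      have i: "i = next_var \<sigma> mod s" "buffer \<sigma> i = Out (next_var \<sigma>)" "next_var \<sigma> \<in> S"
        using locw set_empty by (auto simp: local_inv_def)
      \<comment> \<open>This must be recorded while the unit is still buffered: once the cell is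
        empty, \<open>in_window\<close> no longer yields it, and \<open>fetch_add\<close> relies on
        it.\<close>
      have n: "next_var \<sigma> \<notin> storable \<sigma>" using win i by (auto simp: in_window_def)
      have win': "in_window s \<sigma>'" using win sub set_empty unfolding in_window_def by auto
      have "local_inv s ?S \<sigma>' (unsent \<sigma>' v) (control \<sigma>' v)" for v
      proof (cases "v = w")
        case True
        then show ?thesis using set_empty i n sub by (auto simp: local_inv_def)
      next
        case False
        then have "\<not> critical (control \<sigma> v)" using crit set_empty by simp
        from local_inv_not_critical[OF loc this, where S' = ?S and \<sigma>' = \<sigma>']
        show ?thesis using False set_empty by simp
      qed
      then show ?thesis using win' above sub sent set_empty by auto
    next
      case (fetch_add t b i)
      have i: "i = next_var \<sigma> mod s" "buffer \<sigma> i = EMPTY" "next_var \<sigma> \<in> S"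
        and n: "next_var \<sigma> \<notin> storable \<sigma>"
        using locw fetch_add by (auto simp: local_inv_def)
      have eq: "next_var \<sigma>' = Suc (next_var \<sigma>)" "buffer \<sigma>' = buffer \<sigma>"
        using fetch_add by simp_all
      have win': "in_window s \<sigma>'"
        unfolding in_window_def eq
      proof (intro allI impI)
        fix j u
        assume u: "buffer \<sigma> j = Out u"
        then have w: "j = u mod s" "u \<notin> storable \<sigma>" "next_var \<sigma> \<le> u" "u < next_var \<sigma> + s"
          using win by (auto simp: in_window_def)
        \<comment> \<open>Otherwise \<open>j\<close> would be the cell \<open>i\<close>, which is
          empty.\<close>
        have "u \<noteq> next_var \<sigma>" using u w(1) i by auto
        then show "j = u mod s \<and> u \<notin> storable \<sigma>' \<and> Suc (next_var \<sigma>) \<le> u \<and>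
            u < Suc (next_var \<sigma>) + s"
          using w sub by auto
      qed
      have "local_inv s ?S \<sigma>' (unsent \<sigma>' v) (control \<sigma>' v)" for v
      proof (cases "v = w")
        case True
        then show ?thesis using fetch_add by (auto simp: local_inv_def)
      next
        case False
        then have "\<not> critical (control \<sigma> v)" using crit fetch_add by simp
        from local_inv_not_critical[OF loc this, where S' = ?S and \<sigma>' = \<sigma>']
        show ?thesis using False fetch_add by simp
      qed
      moreover have "storable \<sigma>' \<subseteq> {next_var \<sigma>'..}"
      proof
        fix x
        assume "x \<in> storable \<sigma>'"
        then have "x \<in> storable \<sigma>" using sub by blast
        \<comment> \<open>The lower bound can move up by one because unit
          \<open>next_var \<sigma>\<close> itself is no longer storable.\<close>
        then have "next_var \<sigma> \<le> x" "x \<noteq> next_var \<sigma>" using above n by auto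
        then show "x \<in> {next_var \<sigma>'..}" unfolding eq by simp
      qed
      moreover have "{1..<next_var \<sigma>'} \<subseteq> ?S"
        using sent i(3) unfolding eq by (auto simp: less_Suc_eq)
      ultimately show ?thesis using win' by blast
    qed (use False in auto)
  qed
  then show ?thesis using own' mut' by (simp add: inv_def)
qed

theorem theorem3p1:
  fixes W :: "'w set" and s :: nat and N :: enat
    and \<sigma> :: "nat \<Rightarrow> 'w state" and w :: "nat \<Rightarrow> 'w" and e :: "nat \<Rightarrow> event"
  assumes "finite W" and "s \<ge> 1" and "execution W s N \<sigma> w e"
  shows "\<forall>t\<ge>1. \<forall>k. enat k < N \<and> e k = SendDownstream t \<longrightarrow>
           (\<forall>u\<in>{1..<t}. \<exists>j<k. e j = SendDownstream u)"
proof -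
  let ?S = "\<lambda>k. {u. \<exists>j<k. e j = SendDownstream u}"
  have st: "step s (w k) (e k) (\<sigma> k) (\<sigma> (Suc k))" if "enat k < N" for k
    using assms(3) that by (auto simp: execution_def)
  have inv: "inv s (?S k) (\<sigma> k)" if "enat k \<le> N" for k
    using that
  proof (induction k)
    case 0
    then show ?case using assms(3) by (simp add: execution_def inv_initial)
  next
    case (Suc k)
    then have k: "enat k < N" by (simp add: Suc_ile_eq)
    have "?S (Suc k) = ?S k \<union> {u. e k = SendDownstream u}" by (auto simp: less_Suc_eq)
    then show ?case using inv_step[OF Suc.IH st] k by simp
  qed
  show ?thesis
  proof (intro allI impI ballI)
    fix t k u
    assume k: "enat k < N \<and> e k = SendDownstream t" and u: "u \<in> {1..<t}"
    have I: "inv s (?S k) (\<sigma> k)" using inv k by (simp add: order_less_imp_le)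
    \<comment> \<open>Hence the part \<open>{1..<next_var \<sigma>} \<subseteq> S\<close> of
      \<open>inv\<close> covers exactly the units before \<open>t\<close>, with \<open>S\<close>
      being those sent in the first \<open>k\<close> steps.\<close>
    have "t = next_var (\<sigma> k)" using sent_unit_eq_next[OF I] st k by metis
    then show "\<exists>j<k. e j = SendDownstream u" using I u by (auto simp: inv_def)
  qed
qed

end
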